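(* Let $m\ge1$ be an integer. For each $l=1,\dots,m$ let $\mathbb{T}_l$ be a time scale, let $\alpha_l<\beta_l$ be points of $\mathbb{T}_l$, and let $\psi_l,\phi_l:[\alpha_l,\beta_l]_{\mathbb{T}_l}\to(0,\infty)$ and $\varphi_l:\mathbb{R}\times[\alpha_l,\beta_l]_{\mathbb{T}_l}\to(0,\infty)$ be functions such that the derivatives below exist and the Delta integrals below converge. Suppose that either (a) for all $l=1,\dots,m$, $\psi_l/\phi_l$ is increasing and $\displaystyle\frac{\partial}{\Delta_l\upsilon}\Big(\frac{\partial\varphi_l(s,\upsilon)/\partial s}{\varphi_l(s,\upsilon)}\Big)\ge0$ for all $s\in\mathbb{R}$, $\upsilon\in[\alpha_l,\beta_l]_{\mathbb{T}_l}$; or (b) for all $l=1,\dots,m$, $\psi_l/\phi_l$ is decreasing and $\displaystyle\frac{\partial}{\Delta_l\upsilon}\Big(\frac{\partial\varphi_l(s,\upsilon)/\partial s}{\varphi_l(s,\upsilon)}\Big)\le0$ for all $s\in\mathbb{R}$, $\upsilon\in[\alpha_l,\beta_l]_{\mathbb{T}_l}$. Then the function $$s\mapsto\frac{\prod_{l=1}^m\int_{\alpha_l}^{\beta_l}\psi_l(\upsilon)\varphi_l(s,\upsilon)\,\Delta_l\upsilon}{\prod_{l=1}^m\int_{\alpha_l}^{\beta_l}\phi_l(\upsilon)\varphi_l(s,\upsilon)\,\Delta_l\upsilon}$$ is increasing on $\mathbb{R}^+=(0,\infty)$.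
   Context: A time scale $\mathbb{T}$ is a nonempty closed subset of $\mathbb{R}$, and $[\alpha,\beta]_{\mathbb{T}}=[\alpha,\beta]\cap\mathbb{T}$. The notation $\frac{\partial}{\Delta_l\upsilon}$ denotes the Delta derivative on $\mathbb{T}_l$ with respect to $\upsilon$: with $\sigma(t)=\inf\{r\in\mathbb{T}_l:r>t\}$, $f^\Delta(t)$ is the number such that for every $\varepsilon>0$ there is a neighbourhood $U$ of $t$ with $|f(\sigma(t))-f(r)-f^\Delta(t)(\sigma(t)-r)|\le\varepsilon|\sigma(t)-r|$ for all $r\in U\cap\mathbb{T}_l$ (not considered at the right endpoint $\beta_l$ if it is left-scattered). The symbol $\int_a^b f(\upsilon)\,\Delta_l\upsilon$ denotes the standard Delta integral on $\mathbb{T}_l$, i.e. the integral of $f$ over $[a,b)\cap\mathbb{T}_l$ with respect to the Delta measure on $\mathbb{T}_l$, determined by assigning mass $d-c$ to $[c,d)\cap\mathbb{T}_l$ for $c\le d$ in $\mathbb{T}_l$. "Increasing" and "decreasing" are meant in the non-strict sense. *)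

theory Defs
  imports "HOL-Analysis.Analysis"
begin

definition time_scale :: "real set \<Rightarrow> bool" where
  "time_scale T \<longleftrightarrow> T \<noteq> {} \<and> closed T"

(* Itself a time scale: a function given only on ts_interval T a b is delta differentiated
   with respect to this set.  At t < b its forward jump is that of T. *)
definition ts_interval :: "real set \<Rightarrow> real \<Rightarrow> real \<Rightarrow> real set" where
  "ts_interval T a b = {a..b} \<inter> T"

(* The conventions Inf {} = Sup T and Sup {} = Inf T are spelled out, because
   Inf {} and Sup {} are unspecified on the reals. *)
definition forward_jump :: "real set \<Rightarrow> real \<Rightarrow> real" where
  "forward_jump T t = (if \<exists>r\<in>T. t < r then Inf {r\<in>T. t < r} else Sup T)"

definition backward_jump :: "real set \<Rightarrow> real \<Rightarrow> real" where
  "backward_jump T t = (if \<exists>r\<in>T. r < t then Sup {r\<in>T. r < t} else Inf T)"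

definition left_scattered :: "real set \<Rightarrow> real \<Rightarrow> bool" where
  "left_scattered T t \<longleftrightarrow> backward_jump T t < t"

definition has_delta_derivative ::
  "real set \<Rightarrow> (real \<Rightarrow> real) \<Rightarrow> real \<Rightarrow> real \<Rightarrow> bool" where
  "has_delta_derivative T f D t \<longleftrightarrow>
     (\<forall>\<epsilon>>0. \<exists>U. open U \<and> t \<in> U \<and>
        (\<forall>r\<in>U \<inter> T. \<bar>f (forward_jump T t) - f r - D * (forward_jump T t - r)\<bar>
                     \<le> \<epsilon> * \<bar>forward_jump T t - r\<bar>))"

definition delta_differentiable :: "real set \<Rightarrow> (real \<Rightarrow> real) \<Rightarrow> real \<Rightarrow> bool" where
  "delta_differentiable T f t \<longleftrightarrow> (\<exists>D. has_delta_derivative T f D t)"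

(* Uniquely determined wherever it exists, except at a left-scattered maximum of T. *)
definition delta_deriv :: "real set \<Rightarrow> (real \<Rightarrow> real) \<Rightarrow> real \<Rightarrow> real" where
  "delta_deriv T f t = (SOME D. has_delta_derivative T f D t)"

(* The points of the interval at which delta derivatives are considered. *)
definition ts_interval_kappa :: "real set \<Rightarrow> real \<Rightarrow> real \<Rightarrow> real set" where
  "ts_interval_kappa T a b = {t \<in> ts_interval T a b. \<not> (t = b \<and> left_scattered T b)}"

(* The completion makes the measurable sets those of the Caratheodory extension, as is
   customary for the Lebesgue delta integral.  If T has a maximum, the defining half-open
   intervals do not determine the mass of {Max T}; this point lies in no set
   {a..<b} Int T with a, b in T, so it does not affect any integral below. *)
definition delta_measure :: "real set \<Rightarrow> real measure" where
  "delta_measure T = completion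
     (extend_measure T {(c, d). c \<in> T \<and> d \<in> T \<and> c \<le> d}
        (\<lambda>(c, d). {c..<d} \<inter> T) (\<lambda>(c, d). ennreal (d - c)))"

definition delta_integrable :: "real set \<Rightarrow> real \<Rightarrow> real \<Rightarrow> (real \<Rightarrow> real) \<Rightarrow> bool" where
  "delta_integrable T a b f \<longleftrightarrow> set_integrable (delta_measure T) ({a..<b} \<inter> T) f"

definition delta_integral :: "real set \<Rightarrow> real \<Rightarrow> real \<Rightarrow> (real \<Rightarrow> real) \<Rightarrow> real" where
  "delta_integral T a b f = set_lebesgue_integral (delta_measure T) ({a..<b} \<inter> T) f"

(* The prescribed masses do extend to a measure (the image of Lebesgue measure under
   x |-> Sup {r : T. r <= x}), so that extend_measure is not the null measure. *)
lemma emeasure_delta_measure: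
  assumes T: "time_scale T" and cd: "c \<in> T" "d \<in> T" "c \<le> d"
  shows "emeasure (delta_measure T) ({c..<d} \<inter> T) = ennreal (d - c)"
proof -
  define I where "I = {(c, d). c \<in> T \<and> d \<in> T \<and> c \<le> d}"
  define G where "G = (\<lambda>(c::real, d). {c..<d} \<inter> T)"
  define M where "M = extend_measure T I G (\<lambda>(c, d). ennreal (d - c))"
  define p where "p x = Sup {r\<in>T. r \<le> x}" for x
  define A where "A = {x. \<exists>r\<in>T. r \<le> x}"
  have closed: "closed T" and ne: "T \<noteq> {}"
    using T by (auto simp: time_scale_def)
  have sub: "G ` I \<subseteq> Pow T"
    by (auto simp: G_def)
  have space_M: "space M = T" and sets_M: "sets M = sigma_sets T (G ` I)"
    unfolding M_def using sub by (auto simp: space_extend_measure sets_extend_measure)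
  have A: "A \<in> sets borel"
  proof (cases "bdd_below T")
    case True
    then have "A = {Inf T..}"
      using closed_contains_Inf[OF ne True closed]
      by (auto simp: A_def intro: cInf_lower order_trans)
    then show ?thesis by simp
  next
    case False
    then have "A = UNIV"
      unfolding A_def bdd_below_def by (auto simp: not_le intro: less_imp_le)
    then show ?thesis by simp
  qed
  have p: "p x \<in> T" "p x \<le> x" "\<And>r. r \<in> T \<Longrightarrow> r \<le> x \<Longrightarrow> r \<le> p x" if "x \<in> A" for x
  proof -
    have ne': "{r\<in>T. r \<le> x} \<noteq> {}" and bdd: "bdd_above {r\<in>T. r \<le> x}"
      using that by (auto simp: A_def)
    have "closed {r\<in>T. r \<le> x}"
      using closed_Int[OF closed closed_atMost[of x]] by (simp add: Int_def)
    from closed_contains_Sup[OF ne' bdd this]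
    show "p x \<in> T" "p x \<le> x" by (auto simp: p_def)
    show "r \<le> p x" if "r \<in> T" "r \<le> x" for r
      unfolding p_def using that bdd by (auto intro: cSup_upper)
  qed
  have vimage: "p -` ({c..<d} \<inter> T) \<inter> A = {c..<d}" if "c \<in> T" "d \<in> T" for c d
  proof (intro equalityI subsetI)
    fix x assume x: "x \<in> p -` ({c..<d} \<inter> T) \<inter> A"
    then have "c \<le> x" using p(2)[of x] by auto
    moreover have "x < d" using x p(3)[of x d] that by force
    ultimately show "x \<in> {c..<d}" by simp
  next
    fix x assume x: "x \<in> {c..<d}"
    then have "x \<in> A" using that by (auto simp: A_def)
    then show "x \<in> p -` ({c..<d} \<inter> T) \<inter> A"
      using x p[of x] that by force
  qed
  define N where "N = restrict_space lborel A"
  have space_N: "space N = A"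
    by (simp add: N_def space_restrict_space)
  have [measurable]: "p \<in> measurable N M"
  proof (rule measurable_sigma_sets[OF sets_M])
    show "G ` I \<subseteq> Pow T" by fact
    show "p \<in> space N \<rightarrow> T" using p(1) by (simp add: space_N)
    fix y assume "y \<in> G ` I"
    then obtain c d where cd: "c \<in> T" "d \<in> T" "y = {c..<d} \<inter> T"
      by (auto simp: G_def I_def)
    have "{c..<d} \<subseteq> A" using cd by (auto simp: A_def)
    then show "p -` y \<inter> space N \<in> sets N"
      unfolding space_N cd(3) vimage[OF cd(1,2)]
      using A by (auto simp: N_def sets_restrict_space_iff)
  qed
  have in_sets: "G i \<in> sets M" if "i \<in> I" for i
    using that by (auto simp: sets_M)
  have eq: "emeasure (distr N M p) (G i) = (case i of (c, d) \<Rightarrow> ennreal (d - c))" if "i \<in> I" for i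
  proof -
    obtain c d where i: "i = (c, d)" and cd: "c \<in> T" "d \<in> T" "c \<le> d"
      using \<open>i \<in> I\<close> by (auto simp: I_def)
    have sub: "{c..<d} \<subseteq> A" using cd by (auto simp: A_def)
    have "emeasure (distr N M p) (G i) = emeasure N (p -` G i \<inter> space N)"
      using in_sets[OF \<open>i \<in> I\<close>] by (simp add: emeasure_distr)
    also have "p -` G i \<inter> space N = {c..<d}"
      unfolding space_N using vimage[OF cd(1,2)] by (simp add: i G_def)
    also have "emeasure N {c..<d} = ennreal (d - c)"
      using A sub cd by (simp add: N_def emeasure_restrict_space)
    finally show ?thesis by (simp add: i)
  qed
  have "emeasure M (G (c, d)) = (case (c, d) of (c, d) \<Rightarrow> ennreal (d - c))"
  proof (rule emeasure_extend_measure[OF M_def eq sub])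
    show "positive (sets M) (emeasure (distr N M p))"
      "countably_additive (sets M) (emeasure (distr N M p))"
      using emeasure_positive[of "distr N M p"] emeasure_countably_additive[of "distr N M p"]
      by simp_all
  qed (use cd in \<open>auto simp: I_def\<close>)
  moreover have "(c, d) \<in> I" using cd by (simp add: I_def)
  ultimately have "emeasure (completion M) (G (c, d)) = ennreal (d - c)"
    using in_sets by simp
  then show ?thesis
    by (simp add: delta_measure_def M_def I_def G_def)
qed

end

theory Submission
  imports Defs
begin

text \<open>
  Write \<open>F s\<close> for \<open>\<Phi> l s\<close>.  The hypothesis on the delta derivative makes
  \<open>\<partial>/\<partial>s (ln F s y - ln F s x)\<close> of constant sign for \<open>x \<le> y\<close>, so for \<open>s \<le> t\<close> the ratio
  \<open>F t / F s\<close> is monotone in the same direction as \<open>\<psi> l / \<phi> l\<close>.  Hence the product of the two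
  \<open>2 \<times> 2\<close> determinants of \<open>(\<psi>, \<phi>)\<close> and \<open>(F t, F s)\<close> at any points \<open>x, y\<close> is nonnegative, and
  integrating it in both variables is Chebyshev's inequality
  \<open>\<integral>\<psi> F t * \<integral>\<phi> F s \<ge> \<integral>\<psi> F s * \<integral>\<phi> F t\<close>.
\<close>

section \<open>Delta derivatives at a point, continuity and forward jumps\<close>

lemma has_delta_derivative_minus:
  assumes "has_delta_derivative S f D t"
  shows "has_delta_derivative S (\<lambda>x. - f x) (- D) t"
proof -
  have "\<bar>- f u - - f r - - D * (u - r)\<bar> = \<bar>f u - f r - D * (u - r)\<bar>" for u r
    by (simp add: abs_if algebra_simps)
  then show ?thesis
    using assms unfolding has_delta_derivative_def by simp
qed

text \<open>Adding a small positive slope turns a nonnegative delta derivative into a strictly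
  positive one, the case in which a local increase can be read off directly.\<close>

lemma has_delta_derivative_add_linear:
  assumes "has_delta_derivative S f D t"
  shows "has_delta_derivative S (\<lambda>x. f x + c * x) (D + c) t"
proof -
  have "(f u + c * u) - (f r + c * r) - (D + c) * (u - r) = f u - f r - D * (u - r)" for u r
    by (simp add: algebra_simps)
  then show ?thesis
    using assms unfolding has_delta_derivative_def by (simp only:)
qed

lemma has_delta_derivativeD:
  assumes "has_delta_derivative S f D t" "\<epsilon> > 0"
  shows "\<exists>\<delta>>0. \<forall>r\<in>S. \<bar>r - t\<bar> < \<delta> \<longrightarrow>
    \<bar>f (forward_jump S t) - f r - D * (forward_jump S t - r)\<bar> \<le> \<epsilon> * \<bar>forward_jump S t - r\<bar>"
proof -
  obtain U where U: "open U" "t \<in> U"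
    "\<forall>r\<in>U \<inter> S.
       \<bar>f (forward_jump S t) - f r - D * (forward_jump S t - r)\<bar> \<le> \<epsilon> * \<bar>forward_jump S t - r\<bar>"
    using assms(1)[unfolded has_delta_derivative_def, rule_format, OF assms(2)]
    by (elim exE conjE)
  obtain \<delta> where "\<delta> > 0" "ball t \<delta> \<subseteq> U"
    using openE[OF U(1,2)] by blast
  then show ?thesis
    using U(3) by (intro exI[of _ \<delta>]) (auto simp: subset_iff dist_real_def abs_minus_commute)
qed

text \<open>The defining estimate may be used at \<open>r\<close> and also at \<open>t\<close>
  itself. Subtracting the two cancels \<open>f u\<close>, where \<open>u\<close> is the forward
  jump, and leaves \<open>f r - f t\<close> close to \<open>D * (r - t)\<close>.\<close>

lemma has_delta_derivative_imp_continuous: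
  assumes f: "has_delta_derivative S f D t" and t: "t \<in> S"
  shows "continuous (at t within S) f"
proof -
  define u where "u = forward_jump S t"
  have "\<exists>\<delta>>0. \<forall>r\<in>S. \<bar>r - t\<bar> < \<delta> \<longrightarrow> \<bar>f r - f t\<bar> < e" if e: "e > 0" for e
  proof -
    \<comment> \<open>For \<open>\<bar>r - t\<bar>\<close> below both 1 and
      \<open>\<epsilon>\<close>, the three error terms add up to at most
      \<open>\<epsilon> * (2 * \<bar>u - t\<bar> + 1 + \<bar>D\<bar>)\<close>. The constant 2 in
      place of 1 makes this strictly less than \<open>\<epsilon> * K\<close>, which equals
      \<open>e / 2\<close>.\<close>
    define K where "K = 2 * \<bar>u - t\<bar> + 2 + \<bar>D\<bar>"
    have K: "K \<ge> 2" by (simp add: K_def)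
    define \<epsilon> where "\<epsilon> = e / (2 * K)"
    have \<epsilon>: "\<epsilon> > 0" using e K by (simp add: \<epsilon>_def)
    obtain \<delta> where \<delta>: "\<delta> > 0"
      "\<And>r. r \<in> S \<Longrightarrow> \<bar>r - t\<bar> < \<delta> \<Longrightarrow> \<bar>f u - f r - D * (u - r)\<bar> \<le> \<epsilon> * \<bar>u - r\<bar>"
      using has_delta_derivativeD[OF f \<epsilon>] unfolding u_def by blast
    define d where "d = min \<delta> (min 1 \<epsilon>)"
    have "\<bar>f r - f t\<bar> < e" if r: "r \<in> S" "\<bar>r - t\<bar> < d" for r
    proof -
      have 1: "\<bar>f u - f r - D * (u - r)\<bar> \<le> \<epsilon> * \<bar>u - r\<bar>"
        using \<delta>(2)[of r] r by (simp add: d_def)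
      have 2: "\<bar>f u - f t - D * (u - t)\<bar> \<le> \<epsilon> * \<bar>u - t\<bar>"
        using \<delta>(2)[OF t] \<delta>(1) by simp
      have "\<bar>f r - f t\<bar> = \<bar>(f u - f t - D * (u - t)) - (f u - f r - D * (u - r)) + D * (r - t)\<bar>"
        by (simp add: algebra_simps)
      also have "\<dots> \<le> \<epsilon> * \<bar>u - t\<bar> + \<epsilon> * \<bar>u - r\<bar> + \<bar>D\<bar> * \<bar>r - t\<bar>"
        using 1 2 abs_mult[of D "r - t"] by linarith
      also have "\<dots> \<le> \<epsilon> * \<bar>u - t\<bar> + \<epsilon> * (\<bar>u - t\<bar> + 1) + \<bar>D\<bar> * \<epsilon>"
        using r \<epsilon> by (intro add_mono mult_left_mono) (auto simp: d_def)
      also have "\<dots> < \<epsilon> * K"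
        using \<epsilon> by (simp add: K_def algebra_simps)
      also have "\<dots> < e"
        using e K by (simp add: \<epsilon>_def)
      finally show ?thesis .
    qed
    moreover have "d > 0" using \<delta>(1) \<epsilon> by (simp add: d_def)
    ultimately show ?thesis by blast
  qed
  then show ?thesis
    unfolding continuous_within_eps_delta dist_real_def by blast
qed

lemma forward_jump_props:
  assumes "closed S" "t \<in> S" "y \<in> S" "t < y"
  shows "forward_jump S t \<in> S" "t \<le> forward_jump S t" "forward_jump S t \<le> y"
    and "forward_jump S t = t \<Longrightarrow> \<delta> > 0 \<Longrightarrow> \<exists>r\<in>S. t < r \<and> r < t + \<delta>"
proof -
  define R where "R = {r\<in>S. t < r}"
  have R: "y \<in> R" "bdd_below R"
    using assms by (auto simp: R_def intro: bdd_belowI[of _ t])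
  \<comment> \<open>The point \<open>y\<close> beyond \<open>t\<close> selects the infimum branch of
    \<open>forward_jump\<close>.\<close>
  have eq: "forward_jump S t = Inf R"
    using assms by (auto simp: forward_jump_def R_def)
  have "Inf R \<in> closure R"
    using R by (intro closure_contains_Inf) auto
  also have "closure R \<subseteq> S"
    using assms(1) by (intro closure_minimal) (auto simp: R_def)
  finally show "forward_jump S t \<in> S" by (simp add: eq)
  show "t \<le> forward_jump S t"
    unfolding eq using R by (intro cInf_greatest) (auto simp: R_def)
  show "forward_jump S t \<le> y"
    unfolding eq using R by (intro cInf_lower)
  show "\<exists>r\<in>S. t < r \<and> r < t + \<delta>" if "forward_jump S t = t" "\<delta> > 0"
  proof -
    have "Inf R < t + \<delta>" using that eq by simp
    then show ?thesis
      using cInf_lessD[of R "t + \<delta>"] R by (auto simp: R_def)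
  qed
qed

text \<open>With \<open>\<epsilon> = D\<close> in the defining estimate, the error is at most the
  linear term, so \<open>f\<close> cannot drop. The witness is the forward jump if \<open>t\<close>
  is right-scattered, and any close enough point on the right if \<open>t\<close> is
  right-dense.\<close>

lemma delta_derivative_pos_increase:
  assumes f: "has_delta_derivative S f D t" and D: "D > 0"
    and S: "closed S" "t \<in> S" "y \<in> S" "t < y"
  obtains r where "r \<in> S" "t < r" "r \<le> y" "f t \<le> f r"
proof -
  define u where "u = forward_jump S t"
  obtain \<delta> where \<delta>: "\<delta> > 0"
    "\<And>r. r \<in> S \<Longrightarrow> \<bar>r - t\<bar> < \<delta> \<Longrightarrow> \<bar>f u - f r - D * (u - r)\<bar> \<le> D * \<bar>u - r\<bar>"
    using has_delta_derivativeD[OF f D] unfolding u_def by blast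
  have u: "u \<in> S" "t \<le> u" "u \<le> y"
    using forward_jump_props[OF S] by (simp_all add: u_def)
  show thesis
  proof (cases "u = t")
    case True
    \<comment> \<open>The minimum keeps \<open>r\<close> both inside the neighbourhood of the
      estimate and below \<open>y\<close>.\<close>
    then obtain r where r: "r \<in> S" "t < r" "r < t + min \<delta> (y - t)"
      using forward_jump_props(4)[OF S, of "min \<delta> (y - t)"] \<delta>(1) S(4) by (auto simp: u_def)
    have "\<bar>f t - f r - D * (t - r)\<bar> \<le> D * (r - t)"
      using \<delta>(2)[of r] r True by simp
    then have "f t \<le> f r" by (simp add: abs_le_iff algebra_simps)
    with r show thesis by (intro that[of r]) auto
  next
    case False
    have "\<bar>f u - f t - D * (u - t)\<bar> \<le> D * (u - t)"
      using \<delta>(2)[of t] S(2) \<delta>(1) u by simp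
    then have "f t \<le> f u" by (simp add: abs_le_iff algebra_simps)
    with u False show thesis by (intro that[of u]) auto
  qed
qed

section \<open>Monotonicity from the sign of the delta derivative\<close>

lemma closed_ts_interval: "time_scale T \<Longrightarrow> closed (ts_interval T a b)"
  by (auto simp: time_scale_def ts_interval_def)

lemma continuous_on_ts_interval:
  assumes "\<And>t. t \<in> ts_interval_kappa T a b \<Longrightarrow> delta_differentiable (ts_interval T a b) f t"
  shows "continuous_on (ts_interval T a b) f"
  unfolding continuous_on_eq_continuous_within
proof
  fix t assume t: "t \<in> ts_interval T a b"
  show "continuous (at t within ts_interval T a b) f"
  proof (cases "t \<in> ts_interval_kappa T a b")
    case True
    with t assms show ?thesis
      by (auto simp: delta_differentiable_def intro: has_delta_derivative_imp_continuous)
  next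
    case False
    then have tb: "t = b" and scat: "backward_jump T b < b"
      using t by (auto simp: ts_interval_kappa_def left_scattered_def)
    have gap: "r \<le> backward_jump T b" if "r \<in> T" "r < b" for r
    proof -
      have "r \<le> Sup {r\<in>T. r < b}"
        using that by (intro cSup_upper) (auto intro: bdd_aboveI[of _ b])
      then show ?thesis using that by (auto simp: backward_jump_def)
    qed
    \<comment> \<open>The only point outside \<open>ts_interval_kappa\<close> is a left-scattered
      \<open>b\<close>. It is isolated in the interval by the gap down to its backward jump, so
      continuity there is trivial.\<close>
    have "r = t" if "r \<in> ts_interval T a b" "\<bar>r - t\<bar> < b - backward_jump T b" for r
      using gap[of r] that tb by (fastforce simp: ts_interval_def)
    then show ?thesis
      unfolding continuous_within_eps_delta dist_real_def using scat
      by (metis abs_zero cancel_comm_monoid_add_class.diff_cancel diff_gt_0_iff_gt)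
  qed
qed

text \<open>Consider the last point \<open>z\<close> of the interval up to \<open>y\<close> at which
  \<open>f\<close> is at least \<open>f x\<close>; it exists because continuity makes the set of
  such points closed. If \<open>f y\<close> were smaller than \<open>f x\<close>, then
  \<open>z < y\<close>, and the positive derivative at \<open>z\<close> would produce a later such
  point.\<close>

lemma delta_deriv_pos_imp_le:
  assumes T: "time_scale T"
    and der: "\<And>t. t \<in> ts_interval_kappa T a b \<Longrightarrow>
      \<exists>D>0. has_delta_derivative (ts_interval T a b) f D t"
    and xy: "x \<in> ts_interval T a b" "y \<in> ts_interval T a b" "x \<le> y"
  shows "f x \<le> f y"
proof (rule ccontr)
  assume less: "\<not> f x \<le> f y"
  define S where "S = ts_interval T a b"
  have S: "closed S" using T by (simp add: S_def closed_ts_interval)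
  have cont: "continuous_on S f"
    unfolding S_def using der by (intro continuous_on_ts_interval) (auto simp: delta_differentiable_def)
  define A where "A = {r \<in> S \<inter> {x..y}. f x \<le> f r}"
  define z where "z = Sup A"
  have "A = (S \<inter> {x..y}) \<inter> f -` {f x..}"
    by (auto simp: A_def)
  moreover have "closed \<dots>"
    using S by (intro continuous_closed_preimage continuous_on_subset[OF cont]) auto
  ultimately have "closed A" by simp
  moreover have "x \<in> A" and bdd: "bdd_above A"
    using xy by (auto simp: A_def S_def intro!: bdd_aboveI[of _ y])
  ultimately have z: "z \<in> A"
    unfolding z_def by (intro closed_contains_Sup) auto
  then have "z \<in> S" "z < y"
    using less by (auto simp: A_def less_le)
  moreover have "y \<in> S" "y \<le> b"
    using xy by (auto simp: S_def ts_interval_def)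
  \<comment> \<open>Since \<open>z < y \<le> b\<close>, the point \<open>z\<close> is not the
    possibly excluded endpoint.\<close>
  ultimately have "z \<in> ts_interval_kappa T a b"
    by (auto simp: ts_interval_kappa_def S_def)
  then obtain D where "D > 0" "has_delta_derivative S f D z"
    using der unfolding S_def by blast
  then obtain r where r: "r \<in> S" "z < r" "r \<le> y" "f z \<le> f r"
    using delta_derivative_pos_increase S \<open>z \<in> S\<close> \<open>y \<in> S\<close> \<open>z < y\<close> by metis
  with z have "r \<in> A" by (auto simp: A_def)
  then have "r \<le> z" unfolding z_def using bdd by (rule cSup_upper)
  with r show False by simp
qed

text \<open>Apply the strict case to \<open>f x + c * x\<close> with \<open>c > 0\<close> and let
  \<open>c\<close> tend to 0.\<close>

lemma delta_deriv_nonneg_imp_mono_on: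
  assumes T: "time_scale T"
    and der: "\<And>t. t \<in> ts_interval_kappa T a b \<Longrightarrow>
      \<exists>D\<ge>0. has_delta_derivative (ts_interval T a b) f D t"
  shows "mono_on (ts_interval T a b) f"
proof (rule mono_onI)
  fix x y assume xy: "x \<in> ts_interval T a b" "y \<in> ts_interval T a b" "x \<le> y"
  have le: "f x + c * x \<le> f y + c * y" if "c > 0" for c
  proof (rule delta_deriv_pos_imp_le[OF T _ xy])
    fix t assume "t \<in> ts_interval_kappa T a b"
    then obtain D where "D \<ge> 0" "has_delta_derivative (ts_interval T a b) f D t"
      using der by blast
    then show "\<exists>D>0. has_delta_derivative (ts_interval T a b) (\<lambda>x. f x + c * x) D t"
      using that has_delta_derivative_add_linear by (intro exI[of _ "D + c"]) auto
  qed
  show "f x \<le> f y"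
  proof (rule field_le_epsilon)
    fix e :: real assume e: "e > 0"
    \<comment> \<open>The summand 1 keeps the denominator positive when \<open>x = y\<close>; the
      slope then contributes at most \<open>e\<close> between \<open>x\<close> and
      \<open>y\<close>.\<close>
    define c where "c = e / (y - x + 1)"
    have c: "c > 0" using e xy by (simp add: c_def)
    have "f x \<le> f y + c * (y - x)" using le[OF c] by (simp add: algebra_simps)
    also have "c * (y - x) \<le> c * (y - x + 1)" using c by simp
    also have "\<dots> = e" using xy by (simp add: c_def)
    finally show "f x \<le> f y + e" by simp
  qed
qed

text \<open>\<open>delta_deriv\<close> is a Hilbert choice, so differentiability is what makes a
  sign condition on it say something about \<open>f\<close>.\<close>

lemma has_delta_derivative_delta_deriv:
  "delta_differentiable S f t \<Longrightarrow> has_delta_derivative S f (delta_deriv S f t) t"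
  unfolding delta_differentiable_def delta_deriv_def by (rule someI_ex)

lemma mono_on_delta_deriv:
  assumes "time_scale T"
    and "\<And>t. t \<in> ts_interval_kappa T a b \<Longrightarrow> delta_differentiable (ts_interval T a b) f t"
    and "\<And>t. t \<in> ts_interval_kappa T a b \<Longrightarrow> delta_deriv (ts_interval T a b) f t \<ge> 0"
  shows "mono_on (ts_interval T a b) f"
proof (rule delta_deriv_nonneg_imp_mono_on[OF assms(1)])
  fix t assume t: "t \<in> ts_interval_kappa T a b"
  show "\<exists>D\<ge>0. has_delta_derivative (ts_interval T a b) f D t"
    using has_delta_derivative_delta_deriv[OF assms(2)[OF t]] assms(3)[OF t] by auto
qed

text \<open>The criterion for \<open>mono_on\<close> asks only for some nonnegative derivative, so
  the negative of the chosen derivative of \<open>f\<close> serves as a witness for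
  \<open>- f\<close>.\<close>

lemma antimono_on_delta_deriv:
  assumes "time_scale T"
    and "\<And>t. t \<in> ts_interval_kappa T a b \<Longrightarrow> delta_differentiable (ts_interval T a b) f t"
    and "\<And>t. t \<in> ts_interval_kappa T a b \<Longrightarrow> delta_deriv (ts_interval T a b) f t \<le> 0"
  shows "antimono_on (ts_interval T a b) f"
proof -
  have "mono_on (ts_interval T a b) (\<lambda>x. - f x)"
  proof (rule delta_deriv_nonneg_imp_mono_on[OF assms(1)])
    fix t assume t: "t \<in> ts_interval_kappa T a b"
    show "\<exists>D\<ge>0. has_delta_derivative (ts_interval T a b) (\<lambda>x. - f x) D t"
      using has_delta_derivative_minus[OF has_delta_derivative_delta_deriv[OF assms(2)[OF t]]]
        assms(3)[OF t] by (intro exI[of _ "- delta_deriv (ts_interval T a b) f t"]) simp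
  qed
  then show ?thesis
    by (auto simp: monotone_on_def)
qed

section \<open>Logarithmic derivatives, the determinant inequality and positive integrals\<close>

text \<open>The derivative of \<open>ln q - ln p\<close> is the difference of the logarithmic
  derivatives, hence nonnegative; so \<open>q / p\<close> grows from \<open>s\<close> to
  \<open>t\<close>, written here without division.\<close>

lemma log_deriv_le_imp_ratio_le:
  fixes p q :: "real \<Rightarrow> real"
  assumes pos: "\<And>s. p s > 0" "\<And>s. q s > 0"
    and diff: "\<And>s. p field_differentiable at s" "\<And>s. q field_differentiable at s"
    and le: "\<And>s. deriv p s / p s \<le> deriv q s / q s"
    and st: "s \<le> t"
  shows "p t * q s \<le> q t * p s"
proof -
  have "ln (q s) - ln (p s) \<le> ln (q t) - ln (p t)"
  proof (rule DERIV_nonneg_imp_nondecreasing[where f = "\<lambda>s. ln (q s) - ln (p s)", OF st])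
    fix x
    have dp: "(p has_field_derivative deriv p x) (at x)"
      and dq: "(q has_field_derivative deriv q x) (at x)"
      using diff by (simp_all only: DERIV_deriv_iff_field_differentiable)
    have "((\<lambda>s. ln (q s) - ln (p s)) has_field_derivative
        (deriv q x / q x - deriv p x / p x)) (at x)"
      using DERIV_diff[OF DERIV_chain2[OF DERIV_ln_divide[OF pos(2)] dq]
          DERIV_chain2[OF DERIV_ln_divide[OF pos(1)] dp]] by simp
    moreover have "0 \<le> deriv q x / q x - deriv p x / p x"
      using le by (simp only: diff_ge_0_iff_ge)
    ultimately show "\<exists>y. ((\<lambda>s. ln (q s) - ln (p s)) has_field_derivative y) (at x) \<and> 0 \<le> y"
      by blast
  qed
  then have "ln (p t * q s) \<le> ln (q t * p s)"
    using pos by (simp add: ln_mult_pos)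
  then show ?thesis using pos by simp
qed

text \<open>Expand the product of determinants into four terms, each a function of \<open>x\<close>
  times a function of \<open>y\<close>, and integrate first in \<open>x\<close>, then in
  \<open>y\<close>. The result is twice the difference of the two sides.\<close>

lemma set_integral_det_inequality:
  fixes p q u v :: "'a \<Rightarrow> real"
  assumes int: "set_integrable M X (\<lambda>x. p x * u x)" "set_integrable M X (\<lambda>x. p x * v x)"
      "set_integrable M X (\<lambda>x. q x * u x)" "set_integrable M X (\<lambda>x. q x * v x)"
    and nonneg: "\<And>x y. x \<in> X \<Longrightarrow> y \<in> X \<Longrightarrow>
      0 \<le> (p x * q y - p y * q x) * (u x * v y - u y * v x)"
  shows "(LINT x:X|M. p x * v x) * (LINT x:X|M. q x * u x)
    \<le> (LINT x:X|M. p x * u x) * (LINT x:X|M. q x * v x)"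
proof -
  define PU PV QU QV where "PU = (LINT x:X|M. p x * u x)" and "PV = (LINT x:X|M. p x * v x)"
    and "QU = (LINT x:X|M. q x * u x)" and "QV = (LINT x:X|M. q x * v x)"
  note ints = PU_def PV_def QU_def QV_def
  \<comment> \<open>General coefficients let this serve both integrations: they are values at a
    fixed \<open>y\<close> in the first and integrals over \<open>x\<close> in the second.\<close>
  have lin: "(LINT x:X|M. A * (p x * u x) - B * (p x * v x) - C * (q x * u x) + D * (q x * v x))
      = A * PU - B * PV - C * QU + D * QV" for A B C D
    unfolding ints using int
    by (simp add: set_integral_add set_integral_diff)
  \<comment> \<open>This covers every \<open>g\<close> that is nonnegative on \<open>X\<close>, as
    the Bochner integral of a nonintegrable function is 0.\<close>
  have nonneg_int: "0 \<le> (LINT x:X|M. g x)" if "\<And>x. x \<in> X \<Longrightarrow> 0 \<le> g x" for g :: "'a \<Rightarrow> real"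
    unfolding set_lebesgue_integral_def using that
    by (intro Bochner_Integration.integral_nonneg) (auto simp: indicator_def)
  have inner: "0 \<le> (q y * v y) * PU - (q y * u y) * PV - (p y * v y) * QU + (p y * u y) * QV"
    if y: "y \<in> X" for y
    unfolding lin[symmetric]
  proof (rule nonneg_int)
    fix x assume "x \<in> X"
    from nonneg[OF this y]
    show "0 \<le> (q y * v y) * (p x * u x) - (q y * u y) * (p x * v x)
        - (p y * v y) * (q x * u x) + (p y * u y) * (q x * v x)"
      by (simp add: algebra_simps)
  qed
  \<comment> \<open>The bound \<open>inner\<close> is now read as a function of \<open>y\<close>,
    with the integrals over \<open>x\<close> as constants.\<close>
  have "0 \<le> (LINT y:X|M. QV * (p y * u y) - QU * (p y * v y) - PV * (q y * u y) + PU * (q y * v y))"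
  proof (rule nonneg_int)
    fix y assume "y \<in> X"
    from inner[OF this]
    show "0 \<le> QV * (p y * u y) - QU * (p y * v y) - PV * (q y * u y) + PU * (q y * v y)"
      by (simp add: algebra_simps)
  qed
  then have "PV * QU \<le> PU * QV"
    unfolding lin by (simp add: algebra_simps)
  then show ?thesis by (simp add: ints)
qed

text \<open>A nonnegative integrand with integral 0 vanishes almost everywhere. As \<open>f\<close>
  is positive throughout \<open>X\<close>, that would make \<open>X\<close> a null set.\<close>

lemma set_integral_pos:
  fixes f :: "'a \<Rightarrow> real"
  assumes int: "set_integrable M X f" and X: "emeasure M X \<noteq> 0"
    and pos: "\<And>x. x \<in> X \<Longrightarrow> f x > 0"
  shows "(LINT x:X|M. f x) > 0"
proof -
  \<comment> \<open>\<open>emeasure\<close> is 0 outside the measurable sets, so a nonzero value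
    implies measurability.\<close>
  have sets: "X \<in> sets M" using X emeasure_notin_sets[of X M] by auto
  have nn: "AE x in M. 0 \<le> indicat_real X x *\<^sub>R f x"
    using pos by (intro AE_I2) (auto simp: indicator_def less_imp_le)
  have "(LINT x:X|M. f x) \<noteq> 0"
  proof
    assume "(LINT x:X|M. f x) = 0"
    then have "AE x in M. indicat_real X x *\<^sub>R f x = 0"
      using integral_nonneg_eq_0_iff_AE[OF int[unfolded set_integrable_def] nn]
      by (simp add: set_lebesgue_integral_def)
    then have "AE x in M. x \<notin> X"
      by eventually_elim (use pos in \<open>force simp: indicator_def split: if_splits\<close>)
    then show False
      using X AE_iff_null_sets[OF sets] by auto
  qed
  moreover have "(LINT x:X|M. f x) \<ge> 0"
    unfolding set_lebesgue_integral_def using nn by (rule integral_nonneg_AE)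
  ultimately show ?thesis by simp
qed

section \<open>Ratios of delta integrals: one factor, then the product\<close>

lemma delta_integral_pos:
  assumes "time_scale T" "a \<in> T" "b \<in> T" "a < b" "delta_integrable T a b f"
    and "\<And>x. x \<in> ts_interval T a b \<Longrightarrow> f x > 0"
  shows "delta_integral T a b f > 0"
  unfolding delta_integral_def
proof (rule set_integral_pos)
  \<comment> \<open>The mass of this set is \<open>b - a\<close>, which is positive.\<close>
  show "emeasure (delta_measure T) ({a..<b} \<inter> T) \<noteq> 0"
    using assms(1-4) by (simp add: emeasure_delta_measure)
qed (use assms(5,6) in \<open>auto simp: delta_integrable_def ts_interval_def\<close>)

text \<open>This is the case of a single factor, with the sign of the delta derivative already
  converted into monotonicity of the logarithmic derivative \<open>g s\<close>.\<close>

lemma delta_integral_ratio_mono: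
  fixes \<psi> \<phi> :: "real \<Rightarrow> real" and F :: "real \<Rightarrow> real \<Rightarrow> real"
  defines "g \<equiv> \<lambda>s \<upsilon>. deriv (\<lambda>s. F s \<upsilon>) s / F s \<upsilon>"
  assumes T: "time_scale T" "a \<in> T" "b \<in> T" "a < b"
    and pos: "\<And>\<upsilon>. \<upsilon> \<in> ts_interval T a b \<Longrightarrow> \<psi> \<upsilon> > 0 \<and> \<phi> \<upsilon> > 0"
    and F: "\<And>s \<upsilon>. \<upsilon> \<in> ts_interval T a b \<Longrightarrow> F s \<upsilon> > 0"
      "\<And>s \<upsilon>. \<upsilon> \<in> ts_interval T a b \<Longrightarrow> (\<lambda>s. F s \<upsilon>) field_differentiable at s"
    and int: "\<And>s. s > 0 \<Longrightarrow> delta_integrable T a b (\<lambda>\<upsilon>. \<psi> \<upsilon> * F s \<upsilon>)"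
      "\<And>s. s > 0 \<Longrightarrow> delta_integrable T a b (\<lambda>\<upsilon>. \<phi> \<upsilon> * F s \<upsilon>)"
    and mono: "mono_on (ts_interval T a b) (\<lambda>\<upsilon>. \<psi> \<upsilon> / \<phi> \<upsilon>) \<and> (\<forall>s. mono_on (ts_interval T a b) (g s))
      \<or> antimono_on (ts_interval T a b) (\<lambda>\<upsilon>. \<psi> \<upsilon> / \<phi> \<upsilon>) \<and> (\<forall>s. antimono_on (ts_interval T a b) (g s))"
  shows "mono_on {0<..} (\<lambda>s. delta_integral T a b (\<lambda>\<upsilon>. \<psi> \<upsilon> * F s \<upsilon>)
    / delta_integral T a b (\<lambda>\<upsilon>. \<phi> \<upsilon> * F s \<upsilon>))"
proof (rule mono_onI)
  fix s t :: real assume "s \<in> {0<..}" "t \<in> {0<..}" and st: "s \<le> t"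
  then have s: "s > 0" and t: "t > 0" by auto
  define S where "S = ts_interval T a b"
  have ratio: "F t x * F s y \<le> F t y * F s x"
    if "x \<in> S" "y \<in> S" "\<And>s. g s x \<le> g s y" for x y
    using that F st unfolding S_def g_def
    by (intro log_deriv_le_imp_ratio_le[of "\<lambda>s. F s x" "\<lambda>s. F s y"]) auto
  have quot: "\<psi> x * \<phi> y \<le> \<psi> y * \<phi> x \<longleftrightarrow> \<psi> x / \<phi> x \<le> \<psi> y / \<phi> y"
    if "x \<in> S" "y \<in> S" for x y
    using pos that by (simp add: S_def field_simps)
  \<comment> \<open>For \<open>x \<le> y\<close> both determinants are nonpositive in the increasing
    case and nonnegative in the decreasing case.\<close>
  have det: "0 \<le> (\<psi> x * \<phi> y - \<psi> y * \<phi> x) * (F t x * F s y - F t y * F s x)"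
    if xy: "x \<in> S" "y \<in> S" "x \<le> y" for x y
    using mono
  proof
    assume "mono_on (ts_interval T a b) (\<lambda>\<upsilon>. \<psi> \<upsilon> / \<phi> \<upsilon>) \<and> (\<forall>s. mono_on (ts_interval T a b) (g s))"
    then have "\<psi> x * \<phi> y \<le> \<psi> y * \<phi> x" "F t x * F s y \<le> F t y * F s x"
      using xy ratio[of x y] quot[of x y] by (auto simp: monotone_on_def S_def)
    then show ?thesis by (intro mult_nonpos_nonpos) auto
  next
    assume "antimono_on (ts_interval T a b) (\<lambda>\<upsilon>. \<psi> \<upsilon> / \<phi> \<upsilon>)
      \<and> (\<forall>s. antimono_on (ts_interval T a b) (g s))"
    then have "\<psi> y * \<phi> x \<le> \<psi> x * \<phi> y" "F t y * F s x \<le> F t x * F s y"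
      using xy ratio[of y x] quot[of y x] by (auto simp: monotone_on_def S_def)
    then show ?thesis by (intro mult_nonneg_nonneg) auto
  qed
  have det': "0 \<le> (\<psi> x * \<phi> y - \<psi> y * \<phi> x) * (F t x * F s y - F t y * F s x)"
    if xy: "x \<in> S" "y \<in> S" for x y
  proof (cases "x \<le> y")
    case True
    then show ?thesis using det xy by simp
  next
    case False
    \<comment> \<open>Exchanging \<open>x\<close> and \<open>y\<close> changes the sign of both
      determinants and so preserves their product.\<close>
    then show ?thesis using det[of y x] xy by (simp add: algebra_simps)
  qed
  \<comment> \<open>This is the determinant inequality for the pairs \<open>\<psi>\<close>,
    \<open>\<phi>\<close> and \<open>F t\<close>, \<open>F s\<close>; dividing by the positive
    integrals of \<open>\<phi> \<upsilon> * F s \<upsilon>\<close> and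
    \<open>\<phi> \<upsilon> * F t \<upsilon>\<close> gives the claim.\<close>
  have "delta_integral T a b (\<lambda>\<upsilon>. \<psi> \<upsilon> * F s \<upsilon>) * delta_integral T a b (\<lambda>\<upsilon>. \<phi> \<upsilon> * F t \<upsilon>)
      \<le> delta_integral T a b (\<lambda>\<upsilon>. \<psi> \<upsilon> * F t \<upsilon>) * delta_integral T a b (\<lambda>\<upsilon>. \<phi> \<upsilon> * F s \<upsilon>)"
    unfolding delta_integral_def using int s t
    by (intro set_integral_det_inequality det')
      (auto simp: delta_integrable_def S_def ts_interval_def)
  moreover have "delta_integral T a b (\<lambda>\<upsilon>. \<phi> \<upsilon> * F r \<upsilon>) > 0" if "r > 0" for r
    using int(2)[OF that] F(1) pos by (intro delta_integral_pos[OF T]) auto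
  ultimately show "delta_integral T a b (\<lambda>\<upsilon>. \<psi> \<upsilon> * F s \<upsilon>) / delta_integral T a b (\<lambda>\<upsilon>. \<phi> \<upsilon> * F s \<upsilon>)
      \<le> delta_integral T a b (\<lambda>\<upsilon>. \<psi> \<upsilon> * F t \<upsilon>) / delta_integral T a b (\<lambda>\<upsilon>. \<phi> \<upsilon> * F t \<upsilon>)"
    using s t by (simp add: field_simps)
qed

theorem theorem3p5:
  fixes m :: nat
    and T :: "nat \<Rightarrow> real set"
    and \<alpha> \<beta> :: "nat \<Rightarrow> real"
    and \<psi> \<phi> :: "nat \<Rightarrow> real \<Rightarrow> real"
    and \<Phi> :: "nat \<Rightarrow> real \<Rightarrow> real \<Rightarrow> real"
  assumes "m \<ge> 1"
    and "\<And>l. l \<in> {1..m} \<Longrightarrow> time_scale (T l)"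
    and "\<And>l. l \<in> {1..m} \<Longrightarrow> \<alpha> l \<in> T l \<and> \<beta> l \<in> T l \<and> \<alpha> l < \<beta> l"
    and "\<And>l \<upsilon>. l \<in> {1..m} \<Longrightarrow> \<upsilon> \<in> ts_interval (T l) (\<alpha> l) (\<beta> l) \<Longrightarrow> \<psi> l \<upsilon> > 0 \<and> \<phi> l \<upsilon> > 0"
    and "\<And>l s \<upsilon>. l \<in> {1..m} \<Longrightarrow> \<upsilon> \<in> ts_interval (T l) (\<alpha> l) (\<beta> l) \<Longrightarrow> \<Phi> l s \<upsilon> > 0"
    and "\<And>l s \<upsilon>. l \<in> {1..m} \<Longrightarrow> \<upsilon> \<in> ts_interval (T l) (\<alpha> l) (\<beta> l) \<Longrightarrow>
           (\<lambda>s. \<Phi> l s \<upsilon>) field_differentiable at s"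
    and "\<And>l s \<upsilon>. l \<in> {1..m} \<Longrightarrow> \<upsilon> \<in> ts_interval_kappa (T l) (\<alpha> l) (\<beta> l) \<Longrightarrow>
           delta_differentiable (ts_interval (T l) (\<alpha> l) (\<beta> l))
             (\<lambda>\<upsilon>. deriv (\<lambda>s. \<Phi> l s \<upsilon>) s / \<Phi> l s \<upsilon>) \<upsilon>"
    and "\<And>l s. l \<in> {1..m} \<Longrightarrow> s > 0 \<Longrightarrow>
           delta_integrable (T l) (\<alpha> l) (\<beta> l) (\<lambda>\<upsilon>. \<psi> l \<upsilon> * \<Phi> l s \<upsilon>)"
    and "\<And>l s. l \<in> {1..m} \<Longrightarrow> s > 0 \<Longrightarrow>
           delta_integrable (T l) (\<alpha> l) (\<beta> l) (\<lambda>\<upsilon>. \<phi> l \<upsilon> * \<Phi> l s \<upsilon>)"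
    and "(\<forall>l\<in>{1..m}.
            mono_on (ts_interval (T l) (\<alpha> l) (\<beta> l)) (\<lambda>\<upsilon>. \<psi> l \<upsilon> / \<phi> l \<upsilon>) \<and>
            (\<forall>s. \<forall>\<upsilon>\<in>ts_interval_kappa (T l) (\<alpha> l) (\<beta> l).
               delta_deriv (ts_interval (T l) (\<alpha> l) (\<beta> l))
                 (\<lambda>\<upsilon>. deriv (\<lambda>s. \<Phi> l s \<upsilon>) s / \<Phi> l s \<upsilon>) \<upsilon> \<ge> 0))
       \<or> (\<forall>l\<in>{1..m}.
            antimono_on (ts_interval (T l) (\<alpha> l) (\<beta> l)) (\<lambda>\<upsilon>. \<psi> l \<upsilon> / \<phi> l \<upsilon>) \<and>
            (\<forall>s. \<forall>\<upsilon>\<in>ts_interval_kappa (T l) (\<alpha> l) (\<beta> l).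
               delta_deriv (ts_interval (T l) (\<alpha> l) (\<beta> l))
                 (\<lambda>\<upsilon>. deriv (\<lambda>s. \<Phi> l s \<upsilon>) s / \<Phi> l s \<upsilon>) \<upsilon> \<le> 0))"
  shows "mono_on {0<..}
           (\<lambda>s. (\<Prod>l=1..m. delta_integral (T l) (\<alpha> l) (\<beta> l) (\<lambda>\<upsilon>. \<psi> l \<upsilon> * \<Phi> l s \<upsilon>))
              / (\<Prod>l=1..m. delta_integral (T l) (\<alpha> l) (\<beta> l) (\<lambda>\<upsilon>. \<phi> l \<upsilon> * \<Phi> l s \<upsilon>)))"
  unfolding prod_dividef[symmetric]
\<comment> \<open>The quotient of products has become a product of quotients, which can be compared
  factor by factor because the factors at \<open>s\<close> are nonnegative.\<close>
proof (rule mono_onI, rule prod_mono, rule conjI)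
  fix s t :: real and l
  assume s: "s \<in> {0<..}" and t: "t \<in> {0<..}" and st: "s \<le> t" and l: "l \<in> {1..m}"
  note T = assms(2)[OF l] and ab = assms(3)[OF l]
  show "0 \<le> delta_integral (T l) (\<alpha> l) (\<beta> l) (\<lambda>\<upsilon>. \<psi> l \<upsilon> * \<Phi> l s \<upsilon>)
      / delta_integral (T l) (\<alpha> l) (\<beta> l) (\<lambda>\<upsilon>. \<phi> l \<upsilon> * \<Phi> l s \<upsilon>)"
    using assms(4,5,8,9) s l ab
    by (intro divide_nonneg_nonneg less_imp_le delta_integral_pos[OF T]) auto
  show "delta_integral (T l) (\<alpha> l) (\<beta> l) (\<lambda>\<upsilon>. \<psi> l \<upsilon> * \<Phi> l s \<upsilon>)
      / delta_integral (T l) (\<alpha> l) (\<beta> l) (\<lambda>\<upsilon>. \<phi> l \<upsilon> * \<Phi> l s \<upsilon>)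
    \<le> delta_integral (T l) (\<alpha> l) (\<beta> l) (\<lambda>\<upsilon>. \<psi> l \<upsilon> * \<Phi> l t \<upsilon>)
      / delta_integral (T l) (\<alpha> l) (\<beta> l) (\<lambda>\<upsilon>. \<phi> l \<upsilon> * \<Phi> l t \<upsilon>)"
  proof (rule mono_onD[OF delta_integral_ratio_mono s t st])
    show "mono_on (ts_interval (T l) (\<alpha> l) (\<beta> l)) (\<lambda>\<upsilon>. \<psi> l \<upsilon> / \<phi> l \<upsilon>) \<and>
        (\<forall>s. mono_on (ts_interval (T l) (\<alpha> l) (\<beta> l)) (\<lambda>\<upsilon>. deriv (\<lambda>s. \<Phi> l s \<upsilon>) s / \<Phi> l s \<upsilon>))
      \<or> antimono_on (ts_interval (T l) (\<alpha> l) (\<beta> l)) (\<lambda>\<upsilon>. \<psi> l \<upsilon> / \<phi> l \<upsilon>) \<and>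
        (\<forall>s. antimono_on (ts_interval (T l) (\<alpha> l) (\<beta> l)) (\<lambda>\<upsilon>. deriv (\<lambda>s. \<Phi> l s \<upsilon>) s / \<Phi> l s \<upsilon>))"
      using assms(10)
    \<comment> \<open>Each alternative is specialised to \<open>l\<close> and its derivative
      condition is turned into monotonicity in \<open>\<upsilon>\<close>. The inner \<open>s\<close>
      ranges over all reals, as the comparison of logarithmic derivatives requires.\<close>
    proof (rule disj_forward; intro conjI allI)
      fix s
      assume "\<forall>l\<in>{1..m}. mono_on (ts_interval (T l) (\<alpha> l) (\<beta> l)) (\<lambda>\<upsilon>. \<psi> l \<upsilon> / \<phi> l \<upsilon>) \<and>
        (\<forall>s. \<forall>\<upsilon>\<in>ts_interval_kappa (T l) (\<alpha> l) (\<beta> l).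
          delta_deriv (ts_interval (T l) (\<alpha> l) (\<beta> l)) (\<lambda>\<upsilon>. deriv (\<lambda>s. \<Phi> l s \<upsilon>) s / \<Phi> l s \<upsilon>) \<upsilon> \<ge> 0)"
      note hyp = bspec[OF this l]
      from hyp show "mono_on (ts_interval (T l) (\<alpha> l) (\<beta> l)) (\<lambda>\<upsilon>. \<psi> l \<upsilon> / \<phi> l \<upsilon>)"
        by (rule conjunct1)
      show "mono_on (ts_interval (T l) (\<alpha> l) (\<beta> l)) (\<lambda>\<upsilon>. deriv (\<lambda>s. \<Phi> l s \<upsilon>) s / \<Phi> l s \<upsilon>)"
        using hyp by (intro mono_on_delta_deriv[OF T] assms(7)[OF l]) blast+
    next
      fix s
      assume "\<forall>l\<in>{1..m}. antimono_on (ts_interval (T l) (\<alpha> l) (\<beta> l)) (\<lambda>\<upsilon>. \<psi> l \<upsilon> / \<phi> l \<upsilon>) \<and>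
        (\<forall>s. \<forall>\<upsilon>\<in>ts_interval_kappa (T l) (\<alpha> l) (\<beta> l).
          delta_deriv (ts_interval (T l) (\<alpha> l) (\<beta> l)) (\<lambda>\<upsilon>. deriv (\<lambda>s. \<Phi> l s \<upsilon>) s / \<Phi> l s \<upsilon>) \<upsilon> \<le> 0)"
      note hyp = bspec[OF this l]
      from hyp show "antimono_on (ts_interval (T l) (\<alpha> l) (\<beta> l)) (\<lambda>\<upsilon>. \<psi> l \<upsilon> / \<phi> l \<upsilon>)"
        by (rule conjunct1)
      show "antimono_on (ts_interval (T l) (\<alpha> l) (\<beta> l)) (\<lambda>\<upsilon>. deriv (\<lambda>s. \<Phi> l s \<upsilon>) s / \<Phi> l s \<upsilon>)"
        using hyp by (intro antimono_on_delta_deriv[OF T] assms(7)[OF l]) blast+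
    qed
  qed (use assms(4-6,8,9) l T ab in auto)
qed

end
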